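(* Let $f(x)$ be a polynomial with nonnegative integer coefficients, and let $$U_f:=\bigcup_{\mathcal{S}\in(\mathbb{Z}^+)^{\infty}}\Big\{\sum_{k=1}^{n}\frac{1}{f(k)^{s_k}}\ \Big|\ n\in\mathbb{Z}^+\Big\},$$ where the union is over all infinite sequences $\mathcal{S}=\{s_i\}_{i=1}^{\infty}$ of positive integers. (i) If $\deg f(x)=1$, then $U_f$ is dense in the interval $(\delta,+\infty)$, where $\delta=1$ if $f(x)=x$ and $\delta=0$ otherwise. (ii) If $\deg f(x)\ge 2$ and $$\frac{1}{f(k)}\le\sum_{i=1}^{\infty}\frac{1}{f(k+i)}$$ holds for all positive integers $k$, then $U_f$ is dense in the interval $(0,\alpha_f)$, where $\alpha_f:=\sum_{k=1}^{\infty}\frac{1}{f(k)}$.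
   Context: $(\mathbb{Z}^+)^{\infty}$ denotes the set of all infinite sequences $\{s_i\}_{i=1}^{\infty}$ of positive integers (the $s_i$ need not be distinct nor monotonic). *)

theory Defs
  imports "HOL-Analysis.Analysis" "HOL-Computational_Algebra.Polynomial"
begin

text \<open>Sequences indexed by the positive integers are functions on \<^typ>\<open>nat\<close>; the value at 0
  is unconstrained and never used.\<close>

definition pos_seqs :: "(nat \<Rightarrow> nat) set" where
  "pos_seqs = {s. \<forall>i\<ge>1. s i \<ge> 1}"

definition U :: "int poly \<Rightarrow> real set" where
  "U f = (\<Union>s\<in>pos_seqs. {\<Sum>k=1..n. 1 / real_of_int (poly f (int k)) ^ s k | n. n \<ge> 1})"

text \<open>The series runs over \<open>k \<ge> 1\<close>. As \<^const>\<open>suminf\<close> is only meaningful for summable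
  series, this is to be used for \<open>degree f \<ge> 2\<close>.\<close>

definition alpha :: "int poly \<Rightarrow> real" where
  "alpha f = (\<Sum>k. 1 / real_of_int (poly f (int (Suc k))))"

definition dense_in_interval :: "real set \<Rightarrow> real set \<Rightarrow> bool" where
  "dense_in_interval A I \<longleftrightarrow> I \<subseteq> closure (A \<inter> I)"

end

theory Submission
  imports Defs "HOL-Real_Asymp.Real_Asymp"
begin

text \<open>Terms that are not wanted can be made negligible by a huge exponent, since every
  \<open>1 / f k\<close> (apart from the first one for \<open>f = x\<close>) is at most \<open>1/2\<close>. Hence it suffices
  that the finite subset sums of \<open>1 / f k\<close> are dense, and this follows from Kakeya's greedy
  argument: take each term that still fits below the target. If the last skipped term is the
  \<open>k\<close>-th, the gap at that stage is less than \<open>1 / f k\<close>, hence less than the sum of all later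
  terms, which therefore cannot all be taken; so either nothing is skipped and the target is
  passed, or infinitely many terms are skipped and the gap tends to 0. In degree at least 2 the tail
  condition at \<open>k = 1\<close> rules out \<open>f 1 = 1\<close>, because \<open>f k \<ge> k\<^sup>2\<close> and the inverse squares from
  \<open>2\<^sup>2\<close> on sum to less than 1.\<close>

section \<open>Greedy subset sums and their realization by exponents\<close>

lemma greedy_subset_sum_approx:
  fixes a :: "nat \<Rightarrow> real"
  assumes lim: "a \<longlonglongrightarrow> 0"
    and tail: "\<And>k c. c < a k \<Longrightarrow> \<exists>m. c < sum a {Suc k..<m}"
    and total: "\<exists>m. x < sum a {..<m}"
    and "0 < x" "0 < e"
  shows "\<exists>D. \<exists>n\<ge>1. (\<Sum>i<n. if i \<in> D then a i else 0) \<le> x \<and>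
    x - e < (\<Sum>i<n. if i \<in> D then a i else 0)"
proof -
  \<comment> \<open>\<open>S n\<close> is the greedy sum after the first \<open>n\<close> terms, and
    \<open>D\<close> collects the indices whose term still fitted.\<close>
  define S where "S = rec_nat 0 (\<lambda>n y. if y + a n \<le> x then y + a n else y)"
  define D where "D = {i. S i + a i \<le> x}"
  have S_0: "S 0 = 0" and S_Suc: "S (Suc n) = S n + (if n \<in> D then a n else 0)" for n
    by (simp_all add: S_def D_def)
  have S_eq: "S n = (\<Sum>i<n. if i \<in> D then a i else 0)" for n
    by (induction n) (simp_all add: S_0 S_Suc)
  have S_le: "S n \<le> x" for n
    by (induction n) (use \<open>0 < x\<close> in \<open>auto simp: S_0 S_Suc D_def\<close>)
  have "\<exists>n\<ge>1. x - e < S n"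
  proof (rule ccontr)
    assume "\<not> ?thesis"
    then have gap: "S n \<le> x - e" if "n \<ge> 1" for n
      using that by (meson not_le)
    obtain N where N: "a n < e" if "n \<ge> N" for n
      using order_tendstoD(2)[OF lim \<open>0 < e\<close>] by (auto simp: eventually_sequentially)
    \<comment> \<open>A gap of at least \<open>e\<close> leaves room for any term below
      \<open>e\<close>, so only finitely many indices are skipped. The bound 1 is there because
      \<open>gap\<close> speaks of positive \<open>n\<close> only.\<close>
    have in_D: "n \<in> D" if "n \<ge> max 1 N" for n
      using gap[of n] N[of n] that by (auto simp: D_def)
    show False
    proof (cases "D = UNIV")
      case True
      then have "S n = sum a {..<n}" for n
        by (simp add: S_eq)
      then show False
        using total S_le by (metis not_le)
    next
      case False
      have fin: "finite (- D)"
        by (rule finite_subset[of _ "{..<max 1 N}"]) (use in_D in \<open>force simp: not_less\<close>, simp)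
      \<comment> \<open>\<open>k\<close> is the last skipped index: from there on the greedy sum
        gains every term, and the tail beats the gap left at \<open>k\<close>.\<close>
      define k where "k = Max (- D)"
      have "k \<notin> D"
        using Max_in[OF fin] False by (auto simp: k_def)
      have later: "n \<in> D" if "n > k" for n
        using Max_ge[OF fin, of n] that by (force simp: k_def)
      have S_later: "S (Suc k + j) = S k + sum a {Suc k..<Suc k + j}" for j
        by (induction j) (use \<open>k \<notin> D\<close> later in \<open>simp_all add: S_Suc\<close>)
      have "x - S k < a k"
        using \<open>k \<notin> D\<close> by (simp add: D_def)
      then obtain m where m: "x - S k < sum a {Suc k..<m}"
        using tail by blast
      \<comment> \<open>The gap at \<open>k\<close> is nonnegative, so a sum exceeding it cannot be
        empty.\<close>
      then have "Suc k \<le> m"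
        using S_le[of k] by (cases "Suc k \<le> m") auto
      then show False
        using m S_later[of "m - Suc k"] S_le[of m] by simp
    qed
  qed
  then show ?thesis
    using S_le unfolding S_eq by blast
qed

lemma sum_powers_approx:
  fixes a :: "nat \<Rightarrow> real"
  assumes pos: "\<And>k. 0 < a k" and half: "\<And>k. a k \<le> 1 / 2"
    and lim: "a \<longlonglongrightarrow> 0"
    and tail: "\<And>k c. c < a k \<Longrightarrow> \<exists>m. c < sum a {Suc k..<m}"
    and total: "\<exists>m. x < sum a {..<m}"
    and "0 < x" "0 < e"
  shows "\<exists>s. \<exists>n\<ge>1. (\<forall>i. s i \<ge> (1::nat)) \<and> \<bar>(\<Sum>i<n. a i ^ s i) - x\<bar> < e"
proof -
  obtain D n where "n \<ge> 1"
    and D: "(\<Sum>i<n. if i \<in> D then a i else 0) \<le> x" "x - e < (\<Sum>i<n. if i \<in> D then a i else 0)"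
    using greedy_subset_sum_approx[OF lim tail total \<open>0 < x\<close> \<open>0 < e\<close>] by blast
  \<comment> \<open>Each of the at most \<open>n\<close> unwanted terms may then add up to
    \<open>(1 / 2) ^ M\<close> without the total excess reaching \<open>e\<close>. The exponent used
    is \<open>Suc M\<close>, which is positive even when \<open>M = 0\<close>.\<close>
  obtain M where M: "(1 / 2 :: real) ^ M < e / real n"
    using real_arch_pow_inv[of "e / real n" "1 / 2"] \<open>0 < e\<close> \<open>n \<ge> 1\<close> by auto
  define s where "s i = (if i \<in> D then 1 else Suc M)" for i
  have term_ge: "(if i \<in> D then a i else 0) \<le> a i ^ s i" for i
    using pos[of i] by (simp add: s_def)
  have term_le: "a i ^ s i \<le> (if i \<in> D then a i else 0) + (1 / 2) ^ M" for i
  proof -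
    have "a i ^ Suc M \<le> (1 / 2) ^ Suc M"
      using pos[of i] half[of i] by (intro power_mono) auto
    also have "\<dots> \<le> (1 / 2) ^ M"
      by simp
    finally show ?thesis
      by (simp add: s_def)
  qed
  have "(\<Sum>i<n. a i ^ s i) \<le> (\<Sum>i<n. (if i \<in> D then a i else 0) + (1 / 2) ^ M)"
    by (intro sum_mono term_le)
  also have "\<dots> = (\<Sum>i<n. if i \<in> D then a i else 0) + real n * (1 / 2) ^ M"
    by (simp add: sum.distrib)
  also have "\<dots> < x + e"
    by (rule add_le_less_mono[OF D(1)])
       (use M \<open>n \<ge> 1\<close> in \<open>simp add: pos_less_divide_eq mult.commute\<close>)
  finally have "(\<Sum>i<n. a i ^ s i) < x + e" .
  moreover have "(\<Sum>i<n. if i \<in> D then a i else 0) \<le> (\<Sum>i<n. a i ^ s i)"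
    by (intro sum_mono term_ge)
  ultimately have "\<bar>(\<Sum>i<n. a i ^ s i) - x\<bar> < e"
    using D(2) by linarith
  then show ?thesis
    using \<open>n \<ge> 1\<close> by (intro exI[of _ s] exI[of _ n]) (simp add: s_def)
qed

section \<open>Finite sums from divergent and convergent series\<close>

lemma sum_unbounded_of_not_summable:
  fixes a :: "nat \<Rightarrow> real"
  assumes "\<And>k. 0 \<le> a k" "\<not> summable a"
  shows "\<exists>m. c < sum a {k..<m}"
proof (rule ccontr)
  assume "\<not> ?thesis"
  then have "(\<Sum>i<n. a (i + k)) \<le> c" for n
    using sum.shift_bounds_nat_ivl[of a 0 k n]
    by (metis add_0 atLeast0LessThan not_less)
  then have "summable (\<lambda>i. a (i + k))"
    by (intro summableI_nonneg_bounded) (use assms in auto)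
  then show False
    using assms by (simp add: summable_iff_shift)
qed

text \<open>Partial sums converge to the series, so they eventually pass anything strictly below it.
  This turns a condition on infinite tails into the finite form that the greedy argument
  uses.\<close>

lemma sum_exceeds_below_suminf:
  fixes a :: "nat \<Rightarrow> real"
  assumes "summable a" "c < (\<Sum>i. a (i + k))"
  shows "\<exists>m. c < sum a {k..<m}"
proof -
  have "(\<lambda>n. \<Sum>i<n. a (i + k)) \<longlonglongrightarrow> (\<Sum>i. a (i + k))"
    using assms(1) by (intro summable_LIMSEQ) (simp add: summable_iff_shift)
  then have "\<forall>\<^sub>F n in sequentially. c < (\<Sum>i<n. a (i + k))"
    using assms(2) by (rule order_tendstoD)
  then obtain n where "c < (\<Sum>i<n. a (i + k))"
    by (auto simp: eventually_sequentially)
  then show ?thesis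
    using sum.shift_bounds_nat_ivl[of a 0 k n]
    by (intro exI[of _ "n + k"]) (simp add: atLeast0LessThan)
qed

section \<open>From approximation by \<open>U f\<close> to density, and growth of
  \<open>f\<close>\<close>

lemma dense_in_open_intervalI:
  assumes "open I" "\<And>x e. x \<in> I \<Longrightarrow> 0 < e \<Longrightarrow> \<exists>y\<in>A. \<bar>y - x\<bar> < e"
  shows "dense_in_interval A I"
proof -
  have "I \<subseteq> closure A"
    using assms(2) by (auto simp: closure_approachable dist_real_def)
  \<comment> \<open>Near a point of an open set, approximants from \<open>A\<close> can be taken
    inside that set.\<close>
  then show ?thesis
    using open_Int_closure_subset[OF assms(1), of A]
    by (auto simp: dense_in_interval_def Int_commute)
qed

lemma sum_in_U:
  assumes "n \<ge> 1" "\<And>i. s i \<ge> 1"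
  shows "(\<Sum>i<n. (1 / real_of_int (poly f (int (Suc i)))) ^ s i) \<in> U f"
proof -
  have "(\<Sum>i<n. (1 / real_of_int (poly f (int (Suc i)))) ^ s i)
      = (\<Sum>k=1..n. 1 / real_of_int (poly f (int k)) ^ s (k - 1))"
    using sum.atLeast1_atMost_eq[of "\<lambda>k. 1 / real_of_int (poly f (int k)) ^ s (k - 1)" n]
    by (simp add: power_one_over)
  moreover have "(\<lambda>k. s (k - 1)) \<in> pos_seqs"
    using assms(2) by (simp add: pos_seqs_def)
  ultimately show ?thesis
    using assms(1) unfolding U_def by blast
qed

lemma poly_ge_power_degree:
  fixes f :: "int poly"
  assumes "\<forall>i. coeff f i \<ge> 0" "f \<noteq> 0"
  shows "int k ^ degree f \<le> poly f (int k)"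
proof -
  have "coeff f (degree f) \<ge> 1"
    using assms by (metis leading_coeff_0_iff int_one_le_iff_zero_less order_le_less)
  then have "int k ^ degree f \<le> coeff f (degree f) * int k ^ degree f"
    using mult_right_mono[of 1 "coeff f (degree f)" "int k ^ degree f"] by simp
  also have "\<dots> \<le> (\<Sum>i\<le>degree f. coeff f i * int k ^ i)"
    by (rule member_le_sum) (use assms(1) in auto)
  finally show ?thesis
    by (simp add: poly_altdef)
qed

lemma poly_mono_nonneg_coeffs:
  fixes f :: "'a::linordered_idom poly"
  assumes "\<forall>i. coeff f i \<ge> 0" "0 \<le> x" "x \<le> y"
  shows "poly f x \<le> poly f y"
  unfolding poly_altdef using assms by (intro sum_mono mult_left_mono power_mono) auto

lemma inverse_poly_tendsto_0:
  fixes f :: "int poly"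
  assumes "\<forall>i. coeff f i \<ge> 0" "degree f \<ge> 1"
  shows "(\<lambda>k. 1 / real_of_int (poly f (int (Suc k)))) \<longlonglongrightarrow> 0"
proof (rule real_tendsto_sandwich)
  have ge: "int (Suc k) \<le> poly f (int (Suc k))" for k
  proof -
    have "int (Suc k) \<le> int (Suc k) ^ degree f"
      using assms(2) by (intro self_le_power) auto
    then show ?thesis
      using poly_ge_power_degree[OF assms(1), of "Suc k"] assms(2) by force
  qed
  have "real (Suc k) \<le> real_of_int (poly f (int (Suc k)))" for k
    using ge[of k] by (metis of_int_le_iff of_int_of_nat_eq)
  then show "\<forall>\<^sub>F k in sequentially. 1 / real_of_int (poly f (int (Suc k))) \<le> inverse (real (Suc k))"
    by (intro always_eventually allI) (simp add: inverse_eq_divide frac_le del: of_nat_Suc)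
  show "\<forall>\<^sub>F k in sequentially. 0 \<le> 1 / real_of_int (poly f (int (Suc k)))"
    using ge by (intro always_eventually allI) (metis of_int_0_le_iff of_nat_0_le_iff order_trans zero_le_divide_1_iff)
qed (simp_all add: LIMSEQ_inverse_real_of_nat del: of_nat_Suc)

text \<open>Nonnegative coefficients make \<open>f\<close> increasing in the weak sense, so
  \<open>poly f 1 \<ge> 2\<close> alone bounds all reciprocals by 1/2.\<close>

lemma U_approx:
  fixes f :: "int poly"
  assumes coeffs: "\<forall>i. coeff f i \<ge> 0" and deg: "degree f \<ge> 1" and one: "poly f 1 \<ge> 2"
    and a: "a = (\<lambda>k. 1 / real_of_int (poly f (int (Suc k))))"
    and tail: "\<And>k c. c < a k \<Longrightarrow> \<exists>m. c < sum a {Suc k..<m}"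
    and total: "\<exists>m. x < sum a {..<m}"
    and "0 < x" "0 < e"
  shows "\<exists>y\<in>U f. \<bar>y - x\<bar> < e"
proof -
  have ge: "real_of_int (poly f (int (Suc k))) \<ge> 2" for k
    using poly_mono_nonneg_coeffs[OF coeffs, of 1 "int (Suc k)"] one by simp
  have "0 < a k" for k
    using ge[of k] by (simp add: a)
  moreover have "a k \<le> 1 / 2" for k
    using ge[of k] unfolding a by (intro frac_le) auto
  moreover have "a \<longlonglongrightarrow> 0"
    unfolding a by (rule inverse_poly_tendsto_0[OF coeffs deg])
  ultimately obtain s n where "n \<ge> 1" "\<forall>i. s i \<ge> (1::nat)" "\<bar>(\<Sum>i<n. a i ^ s i) - x\<bar> < e"
    using sum_powers_approx[of a x e] tail total \<open>0 < x\<close> \<open>0 < e\<close> by blast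
  then show ?thesis
    using sum_in_U[of n s f] unfolding a by blast
qed

section \<open>Degree 1: divergence\<close>

lemma not_summable_inverse_linear:
  fixes b c :: int
  assumes "0 \<le> b" "1 \<le> c"
  shows "\<not> summable (\<lambda>k. 1 / real_of_int (poly [:b, c:] (int (Suc k))))"
proof
  assume *: "summable (\<lambda>k. 1 / real_of_int (poly [:b, c:] (int (Suc k))))"
  have "summable (\<lambda>k. 1 / (real_of_int (b + c) * real (Suc k)))"
  proof (rule summable_comparison_test'[OF *])
    fix k :: nat
    \<comment> \<open>Since the argument is at least 1, the constant \<open>b\<close> can be
      absorbed into the slope, which leaves a multiple of the harmonic series.\<close>
    have "poly [:b, c:] (int (Suc k)) \<le> (b + c) * int (Suc k)"
      using assms by (simp add: algebra_simps)
    then have "real_of_int (poly [:b, c:] (int (Suc k))) \<le> real_of_int ((b + c) * int (Suc k))"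
      by (rule iffD2[OF of_int_le_iff])
    moreover have "0 < real_of_int (poly [:b, c:] (int (Suc k)))"
      using assms by (simp add: add_nonneg_pos)
    ultimately show "norm (1 / (real_of_int (b + c) * real (Suc k)))
        \<le> 1 / real_of_int (poly [:b, c:] (int (Suc k)))"
      using assms by (simp add: frac_le)
  qed
  then have "summable (\<lambda>k. real_of_int (b + c) * (1 / (real_of_int (b + c) * real (Suc k))))"
    by (rule summable_mult)
  then have "summable (\<lambda>k. inverse (real (Suc k)))"
    using assms by (simp add: inverse_eq_divide del: of_nat_Suc of_int_add)
  then show False
    using not_summable_harmonic[where 'a = real] summable_iff_shift[of "\<lambda>k. inverse (real k)" 1]
    by simp
qed

text \<open>Here the first term is 1 for every exponent. It is split off, and \<open>x - 1\<close>
  is approximated by powers of 1/2, 1/3, and so on.\<close>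

lemma U_identity_approx:
  assumes "1 < x" "0 < e"
  shows "\<exists>y\<in>U [:0, 1:]. \<bar>y - x\<bar> < e"
proof -
  define a where "a k = 1 / real (Suc (Suc k))" for k
  \<comment> \<open>The shifted harmonic series consists of the reciprocals of the polynomial
    \<open>[:1, 1:]\<close>.\<close>
  have ns: "\<not> summable a"
    using not_summable_inverse_linear[of 1 1] by (simp add: a_def[abs_def] add.commute)
  have nonneg: "0 \<le> a k" for k
    by (simp add: a_def)
  have "a \<longlonglongrightarrow> 0"
    using LIMSEQ_Suc[OF LIMSEQ_inverse_real_of_nat]
    by (simp add: a_def[abs_def] inverse_eq_divide)
  moreover have "\<exists>m. x - 1 < sum a {..<m}"
    using sum_unbounded_of_not_summable[OF nonneg ns, of "x - 1" 0] by (simp add: atLeast0LessThan)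
  ultimately obtain s n where s: "\<forall>i. s i \<ge> (1::nat)"
    and n: "\<bar>(\<Sum>i<n. a i ^ s i) - (x - 1)\<bar> < e"
    using sum_powers_approx[of a "x - 1" e] sum_unbounded_of_not_summable[OF nonneg ns] assms
    by (auto simp: a_def)
  define t where "t i = (if i = 0 then 1 else s (i - 1))" for i
  have "(\<Sum>i<Suc n. (1 / real_of_int (poly [:0, 1:] (int (Suc i)))) ^ t i) = 1 + (\<Sum>i<n. a i ^ s i)"
    by (subst sum.lessThan_Suc_shift) (simp add: t_def a_def)
  moreover have "(\<Sum>i<Suc n. (1 / real_of_int (poly [:0, 1:] (int (Suc i)))) ^ t i) \<in> U [:0, 1:]"
    by (rule sum_in_U) (use s in \<open>auto simp: t_def\<close>)
  ultimately have "1 + (\<Sum>i<n. a i ^ s i) \<in> U [:0, 1:]"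
    by simp
  then show ?thesis
    using n by (intro bexI[of _ "1 + (\<Sum>i<n. a i ^ s i)"]) (simp_all add: algebra_simps)
qed

lemma dense_U_degree_1:
  fixes f :: "int poly"
  assumes coeffs: "\<forall>i. coeff f i \<ge> 0" and deg: "degree f = 1"
  shows "dense_in_interval (U f) {(if f = [:0, 1:] then 1 else 0)<..}"
proof (rule dense_in_open_intervalI)
  fix x e :: real
  assume x: "x \<in> {(if f = [:0, 1:] then 1 else 0)<..}" and "0 < e"
  show "\<exists>y\<in>U f. \<bar>y - x\<bar> < e"
  proof (cases "f = [:0, 1:]")
    case True
    then show ?thesis
      using U_identity_approx[of x e] x \<open>0 < e\<close> by simp
  next
    case False
    obtain b c where f: "f = [:b, c:]"
      using degree1_coeffs[OF deg] by blast
    have bc: "0 \<le> b" "1 \<le> c"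
      using coeffs[rule_format, of 0] coeffs[rule_format, of 1] deg by (auto simp: f split: if_splits)
    \<comment> \<open>\<open>poly f 1\<close> is \<open>b + c\<close>, which equals 1 only for the
      excluded \<open>b = 0\<close>, \<open>c = 1\<close>.\<close>
    then have one: "poly f 1 \<ge> 2"
      using False by (auto simp: f)
    define a where "a = (\<lambda>k. 1 / real_of_int (poly f (int (Suc k))))"
    have ns: "\<not> summable a"
      using not_summable_inverse_linear[OF bc] by (simp add: a_def f)
    have nonneg: "0 \<le> a k" for k
      using bc by (simp add: a_def f)
    have "\<exists>m. x < sum a {..<m}"
      using sum_unbounded_of_not_summable[OF nonneg ns, of x 0] by (simp add: atLeast0LessThan)
    then show ?thesis
      using U_approx[OF coeffs _ one a_def sum_unbounded_of_not_summable[OF nonneg ns]]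
        x False \<open>0 < e\<close> deg by simp
  qed
qed simp

section \<open>Degree at least 2: convergence\<close>

lemma inverse_squares_bound:
  shows "summable (\<lambda>i. 1 / real (i + 2) ^ 2)" and "(\<Sum>i. 1 / real (i + 2) ^ 2) < 1"
proof -
  \<comment> \<open>The half-integer shift gives differences \<open>1 / ((i + 2)^2 - 1/4)\<close>,
    just above the inverse squares, and a telescoped total of 2/3. Telescoping
    \<open>1 / (i + 1)\<close> would give the bound 1, which is not strict.\<close>
  define g where "g i = 1 / (real i + 3 / 2)" for i
  have "g \<longlonglongrightarrow> 0"
    unfolding g_def by real_asymp
  then have sums: "(\<lambda>i. g i - g (Suc i)) sums (g 0 - 0)"
    by (rule telescope_sums')
  have le: "1 / real (i + 2) ^ 2 \<le> g i - g (Suc i)" for i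
  proof -
    have "g i - g (Suc i) = 1 / ((real i + 3 / 2) * (real i + 5 / 2))"
      by (simp add: g_def divide_simps)
    also have "\<dots> \<ge> 1 / real (i + 2) ^ 2"
      by (intro frac_le) (auto simp: power2_eq_square algebra_simps intro!: add_nonneg_pos)
    finally show ?thesis .
  qed
  show summ: "summable (\<lambda>i. 1 / real (i + 2) ^ 2)"
    by (rule summable_comparison_test'[OF sums_summable[OF sums]]) (use le in simp)
  have "(\<Sum>i. 1 / real (i + 2) ^ 2) \<le> g 0 - 0"
    using suminf_le[OF le summ sums_summable[OF sums]] sums_unique[OF sums] by simp
  then show "(\<Sum>i. 1 / real (i + 2) ^ 2) < 1"
    by (simp add: g_def)
qed

lemma dense_U_degree_ge_2:
  fixes f :: "int poly"
  assumes coeffs: "\<forall>i. coeff f i \<ge> 0" and deg: "degree f \<ge> 2"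
    and tails: "\<And>k. k \<ge> 1 \<Longrightarrow> 1 / real_of_int (poly f (int k))
      \<le> (\<Sum>i. 1 / real_of_int (poly f (int (k + Suc i))))"
  shows "dense_in_interval (U f) {0<..<alpha f}"
proof -
  define a where "a = (\<lambda>k. 1 / real_of_int (poly f (int (Suc k))))"
  have ge: "real (Suc k) ^ 2 \<le> real_of_int (poly f (int (Suc k)))" for k
  proof -
    have "int (Suc k) ^ 2 \<le> int (Suc k) ^ degree f"
      using deg by (intro power_increasing) auto
    also have "\<dots> \<le> poly f (int (Suc k))"
      using poly_ge_power_degree[OF coeffs, of "Suc k"] deg by force
    finally have "real_of_int (int (Suc k) ^ 2) \<le> real_of_int (poly f (int (Suc k)))"
      by (rule iffD2[OF of_int_le_iff])
    then show ?thesis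
      by simp
  qed
  have le: "a k \<le> 1 / real (Suc k) ^ 2" and pos: "0 < a k" for k
  proof -
    have "0 < real (Suc k) ^ 2"
      by simp
    then show "a k \<le> 1 / real (Suc k) ^ 2" "0 < a k"
      using ge[of k] order_less_le_trans[OF _ ge[of k], of 0] unfolding a_def
      by (auto intro!: frac_le simp del: of_nat_Suc)
  qed
  have le': "a (i + 1) \<le> 1 / real (i + 2) ^ 2" for i
    using le[of "i + 1"] by (simp add: add.commute)
  have summ': "summable (\<lambda>i. a (i + 1))"
    by (rule summable_comparison_test'[OF inverse_squares_bound(1)])
       (use le' pos in \<open>simp add: less_imp_le\<close>)
  then have summ: "summable a"
    by (rule iffD1[OF summable_iff_shift])
  have tail: "a k \<le> (\<Sum>i. a (i + Suc k))" for k
    using tails[of "Suc k"] by (simp add: a_def add_ac)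
  \<comment> \<open>The tail condition at the first term is compared with the inverse squares from
    \<open>2^2\<close> on.\<close>
  have "a 0 < 1"
    using tail[of 0] suminf_le[OF le' summ' inverse_squares_bound(1)] inverse_squares_bound(2)
    by simp
  \<comment> \<open>The value at 1 exceeds 1 and is an integer.\<close>
  then have one: "poly f 1 \<ge> 2"
    using ge[of 0] by (simp add: a_def divide_simps split: if_splits)
  have alpha: "alpha f = (\<Sum>i. a (i + 0))"
    by (simp add: alpha_def a_def)
  show ?thesis
  proof (rule dense_in_open_intervalI)
    fix x e :: real
    assume x: "x \<in> {0<..<alpha f}" and "0 < e"
    have "\<exists>m. x < sum a {..<m}"
      using sum_exceeds_below_suminf[OF summ, of x 0] x by (simp add: alpha atLeast0LessThan)
    \<comment> \<open>The tail condition is not strict, but \<open>c < a k\<close> is, so a finite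
      part of the tail already exceeds \<open>c\<close>.\<close>
    moreover have "\<exists>m. c < sum a {Suc k..<m}" if "c < a k" for c k
      by (rule sum_exceeds_below_suminf[OF summ order_less_le_trans[OF that tail]])
    ultimately show "\<exists>y\<in>U f. \<bar>y - x\<bar> < e"
      using U_approx[OF coeffs _ one a_def] x \<open>0 < e\<close> deg by simp
  qed simp
qed

theorem theorem1p2:
  fixes f :: "int poly"
  assumes "\<forall>i. coeff f i \<ge> 0"
  shows "(degree f = 1 \<longrightarrow> dense_in_interval (U f) {(if f = [:0, 1:] then 1 else 0)<..}) \<and>
    (degree f \<ge> 2 \<and>
      (\<forall>k::nat. k \<ge> 1 \<longrightarrow>
        1 / real_of_int (poly f (int k)) \<le> (\<Sum>i. 1 / real_of_int (poly f (int (k + Suc i))))) \<longrightarrow>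
      dense_in_interval (U f) {0<..<alpha f})"
  using dense_U_degree_1[OF assms] dense_U_degree_ge_2[OF assms] by blast

end
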